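(* There is an absolute constant $C>0$ such that for every integer $n\geqslant 2$ and all $p_1,\dots,p_n\in[0,1]$, not satisfying $p_1=\cdots=p_n\in\{0,1\}$, for which $\delta<1$, one has \[ d_{\mathrm{TV}}(\mathscr{L}(S_n),\mathscr{B}(n,p))\leqslant \frac{1}{2^{3/2}}\,\delta\,\sqrt{\frac{n}{n-1}\left(1+C\left(\frac{\delta}{1-\delta}+\frac{1}{\sqrt{n}}\,\frac{\delta_3}{\delta}\right)\right)} . \]
   Context: Let $S_n=I_1+\cdots+I_n$ be a sum of independent indicator random variables with $\mathbb{P}(I_j=1)=p_j$ and $\mathbb{P}(I_j=0)=1-p_j$, where $p_j\in[0,1]$; $\mathscr{L}(S_n)$ is its law. Put $p=\frac1n\sum_{j=1}^n p_j$ and $q=1-p$. It is assumed throughout that it is not the case that $p_1=\cdots=p_n\in\{0,1\}$, so that $0<p<1$ and $0<q<1$. $\mathscr{B}(n,p)$ is the binomial distribution with weights $b(n,p;j)=\binom nj p^jq^{n-j}$, $0\leqslant j\leqslant n$. For $m>0$ define \[ \delta_m=\frac{1}{n(pq)^{m/2}}\sum_{j=1}^n|p_j-p|^m,\qquad \delta:=\delta_2 . \] The total variation distance is \[ d_{\mathrm{TV}}(\mathscr{L}(S_n),\mathscr{B}(n,p))=\frac12\sum_{j=0}^n\left|\mathbb{P}(S_n=j)-b(n,p;j)\right|. \] Convention: if $\delta=0$ (all $p_j$ equal), the ratio $\delta_3/\delta$ is read as $0$. *)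

theory Defs
  imports "HOL-Probability.Probability"
begin

definition sum_indicators_pmf :: "nat \<Rightarrow> (nat \<Rightarrow> real) \<Rightarrow> nat pmf" where
  "sum_indicators_pmf n p =
     map_pmf (\<lambda>\<omega>. \<Sum>j=1..n. of_bool (\<omega> j)) (Pi_pmf {1..n} False (\<lambda>j. bernoulli_pmf (p j)))"

(* The law of S_n depends only on the p_j, so the product space above is only a choice of
   realization: any independent indicators on any probability space give the same law. *)
lemma (in prob_space) distr_sum_indicators:
  assumes n: "n \<ge> 1"
    and indep: "indep_vars (\<lambda>_. count_space UNIV) I {1..n}"
    and p: "\<And>j. j \<in> {1..n} \<Longrightarrow> p j \<in> {0..1}"
    and I: "\<And>j. j \<in> {1..n} \<Longrightarrow> prob {\<omega> \<in> space M. I j \<omega>} = p j"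
  shows "distr M (count_space UNIV) (\<lambda>\<omega>. \<Sum>j=1..n. of_bool (I j \<omega>))
           = measure_pmf (sum_indicators_pmf n p)"
proof -
  let ?J = "{1..n}"
  let ?B = "\<lambda>j::nat. measure_pmf (bernoulli_pmf (p j))"
  let ?P = "Pi_pmf ?J False (\<lambda>j. bernoulli_pmf (p j))"
  let ?N = "PiM ?J (\<lambda>_. count_space (UNIV :: bool set))"
  let ?s = "\<lambda>x :: nat \<Rightarrow> bool. \<Sum>j=1..n. of_bool (x j) :: nat"
  have rv: "random_variable (count_space UNIV) (I j)" if "j \<in> ?J" for j
    using indep that unfolding indep_vars_def by auto
  have meas_s: "?s \<in> measurable ?N (count_space UNIV)"
  proof -
    have "?N = count_space (PiE ?J (\<lambda>_. UNIV))"
      by (rule count_space_PiM_finite) auto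
    thus ?thesis by simp
  qed
  have comp: "distr M (count_space UNIV) (I j) = ?B j" if j: "j \<in> ?J" for j
  proof -
    have pj: "p j \<in> {0..1}" using p j by blast
    have m: "I j \<in> measurable M (count_space UNIV)" using rv j .
    have T: "emeasure M (I j -` {True} \<inter> space M) = ennreal (p j)"
      using I[OF j] by (simp add: emeasure_eq_measure vimage_def Int_def conj_commute)
    have "prob (I j -` {False} \<inter> space M) = prob (space M - (I j -` {True} \<inter> space M))"
      by (rule arg_cong[where f = prob]) auto
    also have "\<dots> = 1 - prob (I j -` {True} \<inter> space M)"
      by (rule prob_compl) (use m in \<open>auto intro: measurable_sets\<close>)
    also have "\<dots> = 1 - p j"
      using I[OF j] by (simp add: vimage_def Int_def conj_commute)
    finally have F: "emeasure M (I j -` {False} \<inter> space M) = ennreal (1 - p j)"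
      by (simp add: emeasure_eq_measure)
    show ?thesis
    proof (rule measure_eqI_countable[where A = UNIV])
      fix a :: bool
      show "emeasure (distr M (count_space UNIV) (I j)) {a} = emeasure (?B j) {a}"
        using T F m pj by (cases a) (simp_all add: emeasure_distr emeasure_pmf_single)
    qed auto
  qed
  have restr: "?s (restrict f ?J) = ?s f" for f
    by (rule sum.cong) simp_all
  have ne: "?J \<noteq> {}" using n by simp
  have "distr M ?N (\<lambda>x. \<lambda>i\<in>?J. I i x) = PiM ?J (\<lambda>i. distr M (count_space UNIV) (I i))"
    using iffD1[OF indep_vars_iff_distr_eq_PiM'[where X = I, OF ne rv] indep] by simp
  also have "\<dots> = PiM ?J ?B"
    by (rule PiM_cong) (simp_all only: comp)
  finally have 1: "distr M ?N (\<lambda>x. \<lambda>i\<in>?J. I i x) = PiM ?J ?B" .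
  have "distr (measure_pmf ?P) ?N (\<lambda>x. \<lambda>i\<in>?J. x i)
      = PiM ?J (\<lambda>i. distr (measure_pmf ?P) (count_space UNIV) (\<lambda>x. x i))"
    using iffD1[OF prob_space.indep_vars_iff_distr_eq_PiM'[OF prob_space_measure_pmf ne,
        where X = "\<lambda>i x. x i" and M' = "\<lambda>_. count_space UNIV"]
      indep_vars_Pi_pmf[of ?J False "\<lambda>j. bernoulli_pmf (p j)"]] by simp
  also have "\<dots> = PiM ?J ?B"
  proof (rule PiM_cong)
    fix i assume i: "i \<in> ?J"
    have "map_pmf (\<lambda>x. x i) ?P = bernoulli_pmf (p i)"
      using Pi_pmf_component[of ?J i False "\<lambda>j. bernoulli_pmf (p j)"] i by simp
    thus "distr (measure_pmf ?P) (count_space UNIV) (\<lambda>x. x i) = ?B i"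
      by (metis map_pmf_rep_eq)
  qed simp
  finally have 2: "PiM ?J ?B = distr (measure_pmf ?P) ?N (\<lambda>x. restrict x ?J)" by simp
  have "distr M (count_space UNIV) (\<lambda>\<omega>. \<Sum>j=1..n. of_bool (I j \<omega>) :: nat)
        = distr (distr M ?N (\<lambda>x. \<lambda>i\<in>?J. I i x)) (count_space UNIV) ?s"
  proof (subst distr_distr[OF meas_s])
    show "(\<lambda>x. \<lambda>i\<in>?J. I i x) \<in> measurable M ?N"
      using rv by (rule measurable_restrict)
  qed (simp only: o_def restr)
  also have "\<dots> = distr (distr (measure_pmf ?P) ?N (\<lambda>x. restrict x ?J)) (count_space UNIV) ?s"
    using 1 2 by simp
  also have "\<dots> = distr (measure_pmf ?P) (count_space UNIV) ?s"
  proof (subst distr_distr[OF meas_s])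
    show "(\<lambda>x. restrict x ?J) \<in> measurable (measure_pmf ?P) ?N"
      by (simp add: space_PiM)
  qed (simp only: o_def restr)
  also have "\<dots> = measure_pmf (sum_indicators_pmf n p)"
    by (simp add: sum_indicators_pmf_def map_pmf_rep_eq)
  finally show ?thesis .
qed

definition mean_p :: "nat \<Rightarrow> (nat \<Rightarrow> real) \<Rightarrow> real" where
  "mean_p n p = (\<Sum>j=1..n. p j) / real n"

definition delta_m :: "real \<Rightarrow> nat \<Rightarrow> (nat \<Rightarrow> real) \<Rightarrow> real" where
  "delta_m m n p =
     1 / (real n * (mean_p n p * (1 - mean_p n p)) powr (m / 2)) *
     (\<Sum>j=1..n. \<bar>p j - mean_p n p\<bar> powr m)"

(* Total variation distance of two distributions supported on {0..n}. *)
definition dTV :: "nat \<Rightarrow> nat pmf \<Rightarrow> nat pmf \<Rightarrow> real" where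
  "dTV n P Q = 1 / 2 * (\<Sum>j=0..n. \<bar>pmf P j - pmf Q j\<bar>)"

end

theory Submission
  imports Defs "HOL-Computational_Algebra.Polynomial"
begin

text \<open>
  The total variation distance is at most half the square root of the chi-square distance
  between the two laws (\<open>sum_abs_diff_le_chi_square\<close>), and the chi-square distance can be computed exactly. With
  \<open>x_j = (p_j - p) / sqrt (p q)\<close> and the elementary symmetric functions \<open>e_k\<close>, expanding the
  density of the law of the sum in Krawtchouk polynomials gives
  \<open>1 + chi^2 = (\<Sum>k\<le>n. e_k(x)^2 / (n choose k))\<close> (\<open>sum_sq_div_binomial\<close>). Since \<open>\<Sum>j. x_j = 0\<close> and
  \<open>\<Sum>j. x_j^2 = n \<delta>\<close>, the terms for \<open>k = 0, 1, 2\<close> are \<open>1\<close>, \<open>0\<close> and \<open>n \<delta>^2 / (2 (n - 1))\<close>; the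
  last one is the main term of the theorem.

  For the remaining terms, Parseval's identity on the unit circle and the inequality of arithmetic and geometric
  means give \<open>(\<Sum>k\<le>n. e_k(x)^2 t^k s^(n - k)) \<le> (s + t \<delta>)^n\<close> (\<open>sum_esym_sq_homogeneous_le\<close>). Integrating
  this along \<open>s = 1 - t'\<close>, \<open>t = u t'\<close> against the beta integral gives
  \<open>(\<Sum>k\<le>n. u^k e_k(x)^2 / (n choose k)) \<le> 1 / (1 - u \<delta>)\<close> whenever \<open>u \<delta> < 1\<close>
  (\<open>sum_esym_sq_div_binomial_le\<close>), and a suitable \<open>u > 1\<close> bounds the terms with \<open>k \<ge> 3\<close> by
  \<open>16 \<delta>^3 / (1 - \<delta>)\<close>. Factoring out the main term leaves the relative error \<open>32 \<delta> / (1 - \<delta>)\<close>, which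
  is within the error allowed by the theorem because \<open>\<delta>_3 / \<delta> \<ge> 0\<close>.
\<close>

section \<open>Elementary symmetric functions\<close>


definition esym :: "nat \<Rightarrow> 'b set \<Rightarrow> ('b \<Rightarrow> 'a::comm_ring_1) \<Rightarrow> 'a" where
  "esym k A x = (\<Sum>X | X \<subseteq> A \<and> card X = k. \<Prod>i\<in>X. x i)"

text \<open>
  The identity is homogeneous and holds in every commutative ring because it is needed three times:
  for polynomials with \<open>(u, v) = (q + p z, z - 1)\<close> and \<open>(u, v) = (1, c z)\<close>, and for complex
  numbers on a circle.
\<close>

lemma prod_eq_sum_esym:
  fixes u v :: "'a::comm_ring_1"
  assumes A: "finite A"
  shows "(\<Prod>i\<in>A. u + v * x i) = (\<Sum>k\<le>card A. esym k A x * v ^ k * u ^ (card A - k))"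
proof -
  have "(\<Prod>i\<in>A. u + v * x i) = (\<Prod>i\<in>A. v * x i + u)"
    by (simp add: add.commute)
  also have "\<dots> = (\<Sum>X\<in>Pow A. (\<Prod>i\<in>X. x i) * v ^ card X * u ^ (card A - card X))"
    unfolding prod_add[OF A]
    by (rule sum.cong) (use A in \<open>auto simp: prod.distrib card_Diff_subset finite_subset mult_ac\<close>)
  also have "\<dots> = (\<Sum>k\<le>card A. \<Sum>X | X \<in> Pow A \<and> card X = k.
                      (\<Prod>i\<in>X. x i) * v ^ card X * u ^ (card A - card X))"
    by (rule sum.group[symmetric]) (use A in \<open>auto intro: card_mono\<close>)
  also have "\<dots> = (\<Sum>k\<le>card A. esym k A x * v ^ k * u ^ (card A - k))"
    unfolding esym_def sum_distrib_right by (intro sum.cong) auto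
  finally show ?thesis .
qed

lemma esym_cmult: "esym k A (\<lambda>i. c * x i) = c ^ k * esym k A x"
  unfolding esym_def sum_distrib_left by (intro sum.cong) (auto simp: prod.distrib)

lemma esym_of_real:
  "esym k A (\<lambda>i. of_real (x i) :: 'a::{real_algebra_1,comm_ring_1}) = of_real (esym k A x)"
  unfolding esym_def by simp

lemma prod_const_poly: "(\<Prod>i\<in>X. [:x i:]) = [:\<Prod>i\<in>X. x i:]"
  by (induction X rule: infinite_finite_induct) (auto simp: mult.commute)

lemma sum_const_poly: "(\<Sum>i\<in>X. [:x i:]) = [:\<Sum>i\<in>X. x i:]"
  by (induction X rule: infinite_finite_induct) auto

lemma esym_const_poly: "esym k A (\<lambda>i. [:x i:]) = [:esym k A x:]"
  unfolding esym_def by (simp add: prod_const_poly sum_const_poly)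

lemma prod_poly_eq_sum_esym:
  fixes U V :: "'a::comm_ring_1 poly"
  assumes A: "finite A"
  shows "(\<Prod>i\<in>A. U + smult (x i) V) = (\<Sum>k\<le>card A. smult (esym k A x) (V ^ k * U ^ (card A - k)))"
  using prod_eq_sum_esym[OF A, of U V "\<lambda>i. [:x i:]"] by (simp add: esym_const_poly mult_ac)

lemma coeff_prod_linear:
  assumes A: "finite A" and k: "k \<le> card A"
  shows "coeff (\<Prod>i\<in>A. [:1, c * x i:]) k = c ^ k * esym k A (x :: 'b \<Rightarrow> 'a::comm_ring_1)"
proof -
  have *: "[:0, c:] ^ k = monom (c ^ k) k" for k
  proof -
    have "[:0, c:] = monom c 1" by (simp add: monom_altdef)
    thus ?thesis by (simp add: monom_power)
  qed
  have "(\<Prod>i\<in>A. [:1, c * x i:]) = (\<Prod>i\<in>A. 1 + smult (x i) [:0, c:])"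
    by (simp add: mult.commute one_pCons)
  also have "\<dots> = (\<Sum>k\<le>card A. smult (esym k A x) (monom (c ^ k) k))"
    unfolding prod_poly_eq_sum_esym[OF A] by (simp only: * power_one mult_1_right)
  finally show ?thesis using k by (simp add: coeff_sum mult.commute if_distrib cong: if_cong)
qed

lemma esym_0 [simp]: "finite A \<Longrightarrow> esym 0 A x = 1"
proof -
  assume "finite A"
  hence "{X. X \<subseteq> A \<and> card X = 0} = {{}}" by (auto dest: finite_subset)
  thus ?thesis unfolding esym_def by simp
qed

lemma esym_Suc_insert:
  assumes "finite A" "a \<notin> A"
  shows "esym (Suc k) (insert a A) x = esym (Suc k) A x + x a * esym k A x"
proof -
  have eq: "{X. X \<subseteq> insert a A \<and> card X = Suc k} =
          {X. X \<subseteq> A \<and> card X = Suc k} \<union> insert a ` {X. X \<subseteq> A \<and> card X = k}" (is "?L = ?R1 \<union> ?R2")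
  proof (intro equalityI subsetI)
    fix X assume X: "X \<in> ?L"
    show "X \<in> ?R1 \<union> ?R2"
    proof (cases "a \<in> X")
      case True
      hence "X = insert a (X - {a})" "X - {a} \<subseteq> A" "card (X - {a}) = k" using X by auto
      thus ?thesis by blast
    qed (use X in auto)
  next
    fix X assume "X \<in> ?R1 \<union> ?R2"
    thus "X \<in> ?L" using assms by (auto simp: finite_subset card_insert_if)
  qed
  have "esym (Suc k) (insert a A) x = esym (Suc k) A x + (\<Sum>X\<in>?R2. \<Prod>i\<in>X. x i)"
    unfolding esym_def eq by (rule sum.union_disjoint) (use assms in auto)
  also have "(\<Sum>X\<in>?R2. \<Prod>i\<in>X. x i) = (\<Sum>X | X \<subseteq> A \<and> card X = k. x a * (\<Prod>i\<in>X. x i))"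
  proof (subst sum.reindex)
    show "inj_on (insert a) {X. X \<subseteq> A \<and> card X = k}"
      using assms(2) by (auto simp: inj_on_def)
    show "(\<Sum>X | X \<subseteq> A \<and> card X = k. ((\<lambda>X. \<Prod>i\<in>X. x i) \<circ> insert a) X) =
          (\<Sum>X | X \<subseteq> A \<and> card X = k. x a * (\<Prod>i\<in>X. x i))"
      using assms by (intro sum.cong) (auto simp: finite_subset intro!: prod.insert)
  qed
  finally show ?thesis by (simp add: esym_def sum_distrib_left)
qed

lemma esym_Suc_empty [simp]: "esym (Suc k) {} (x :: 'b \<Rightarrow> _) = 0"
proof -
  have "{X. X \<subseteq> {} \<and> card X = Suc k} = ({} :: 'b set set)" by auto
  thus ?thesis unfolding esym_def by (simp only: sum.empty)
qed

lemma esym_1: "finite A \<Longrightarrow> esym (Suc 0) A x = (\<Sum>i\<in>A. x i)"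
  by (induction A rule: finite_induct) (simp_all add: esym_Suc_insert add.commute)

lemma esym_2: "finite A \<Longrightarrow> 2 * esym 2 A x = (\<Sum>i\<in>A. x i)\<^sup>2 - (\<Sum>i\<in>A. (x i)\<^sup>2)"
  by (induction A rule: finite_induct)
     (simp_all add: esym_Suc_insert esym_1 numeral_2_eq_2 algebra_simps)

section \<open>Generating function of the sum of indicators\<close>


lemma pmf_sum_bernoulli:
  assumes A: "finite A" and p: "\<And>i. i \<in> A \<Longrightarrow> 0 \<le> p i \<and> p i \<le> 1"
  shows "pmf (map_pmf (\<lambda>\<omega>. \<Sum>i\<in>A. of_bool (\<omega> i) :: nat) (Pi_pmf A False (\<lambda>i. bernoulli_pmf (p i)))) k
         = coeff (\<Prod>i\<in>A. [:1 - p i, p i:]) k"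
  using A p
proof (induction A arbitrary: k rule: finite_induct)
  case empty
  show ?case by (simp add: pmf_return indicator_def)
next
  case (insert a A)
  let ?S = "\<lambda>A. map_pmf (\<lambda>\<omega>. \<Sum>i\<in>A. of_bool (\<omega> i) :: nat) (Pi_pmf A False (\<lambda>i. bernoulli_pmf (p i)))"
  have IH: "pmf (?S A) k = coeff (\<Prod>i\<in>A. [:1 - p i, p i:]) k" for k
    using insert by simp
  have *: "?S (insert a A) = bernoulli_pmf (p a) \<bind> (\<lambda>b. map_pmf (\<lambda>s. of_bool b + s) (?S A))"
  proof -
    have "(\<Sum>i\<in>A. of_bool (if i = a then b else f i) :: nat) = (\<Sum>i\<in>A. of_bool (f i))"
      for b and f :: "_ \<Rightarrow> bool"
      using insert.hyps by (intro sum.cong) auto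
    thus ?thesis
      using insert.hyps
      by (simp add: Pi_pmf_insert' map_bind_pmf map_pmf_def bind_assoc_pmf bind_return_pmf
               del: sum_of_bool_eq)
  qed
  have "pmf (?S (insert a A)) k = p a * pmf (map_pmf Suc (?S A)) k + (1 - p a) * pmf (?S A) k"
  proof -
    have "(+) (Suc 0) = Suc" "(+) (0 :: nat) = (\<lambda>s. s)" by auto
    thus ?thesis using * insert.prems[of a]
      by (simp add: pmf_bind algebra_simps del: sum_of_bool_eq)
  qed
  also have "pmf (map_pmf Suc (?S A)) k = (case k of 0 \<Rightarrow> 0 | Suc j \<Rightarrow> pmf (?S A) j)"
  proof (cases k)
    case 0
    have "0 \<notin> set_pmf (map_pmf Suc (?S A))" by auto
    thus ?thesis unfolding set_pmf_iff 0 by simp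
  next
    case (Suc j)
    show ?thesis unfolding Suc by (subst pmf_map_inj') auto
  qed
  finally show ?case
    using insert.hyps by (simp add: IH coeff_pCons del: sum_of_bool_eq split: nat.split)
qed

section \<open>The chi-square distance in terms of elementary symmetric functions\<close>

text \<open>
  The Krawtchouk polynomials, orthogonal for the binomial weights \<open>b(n,p;j)\<close>, given through their
  generating function \<open>(1 - v/q)^(n - j) * (1 + v/p)^j\<close> in \<open>v\<close>. In this normalization the squared
  norm of the \<open>k\<close>-th one is \<open>(n choose k) / (p q)^k\<close>.
\<close>

definition krawtchouk :: "real \<Rightarrow> nat \<Rightarrow> nat \<Rightarrow> nat \<Rightarrow> real" where
  "krawtchouk p n k j = coeff ([:1, - 1 / (1 - p):] ^ (n - j) * [:1, 1 / p:] ^ j) k"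

text \<open>
  The functions \<open>c_k(j) = [z^j] (z - 1)^k (q + p z)^(n - k)\<close>, in which the law of the sum is expanded,
  are the Krawtchouk polynomials times the binomial weight, up to the factor \<open>n choose k\<close>. Multiplying \<open>c_k(j)\<close> by
  \<open>(n choose k) w^k\<close> and summing over \<open>k\<close> gives
  \<open>[z^j] (q + p z + w (z - 1))^n = [z^j] ((q - w) + (p + w) z)^n\<close>, which is the binomial weight
  times the generating function of the Krawtchouk polynomials.
\<close>

lemma coeff_krawtchouk_dual:
  assumes p: "0 < p" "p < 1" and j: "j \<le> n" and k: "k \<le> n"
  shows "real (n choose k) * coeff ([:-1, 1:] ^ k * [:1 - p, p:] ^ (n - k)) j
         = real (n choose j) * p ^ j * (1 - p) ^ (n - j) * krawtchouk p n k j"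
proof -
  let ?c = "\<lambda>k. coeff ([:-1, 1:] ^ k * [:1 - p, p:] ^ (n - k)) j"
  let ?K = "[:1, - 1 / (1 - p):] ^ (n - j) * [:1, 1 / p:] ^ j"
  let ?b = "real (n choose j) * p ^ j * (1 - p) ^ (n - j)"
  have "(\<Sum>k\<le>n. monom (real (n choose k) * ?c k) k) = smult ?b ?K"
  proof (rule poly_eq_poly_eq_iff[THEN iffD1], rule ext)
    fix w :: real
    have "[:1 - p - w, p + w:] ^ n = (smult w [:-1, 1:] + [:1 - p, p:]) ^ n"
      by (simp add: add.commute)
    also have "\<dots> = (\<Sum>k\<le>n. smult (real (n choose k) * w ^ k) ([:-1, 1:] ^ k * [:1 - p, p:] ^ (n - k)))"
      by (subst binomial_ring) (simp add: smult_power of_nat_poly mult_ac del: smult_pCons)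
    finally have "coeff ([:1 - p - w, p + w:] ^ n) j = (\<Sum>k\<le>n. real (n choose k) * w ^ k * ?c k)"
      by (simp add: coeff_sum)
    also have "coeff ([:1 - p - w, p + w:] ^ n) j = real (n choose j) * (p + w) ^ j * (1 - p - w) ^ (n - j)"
      using j by (simp add: coeff_linear_poly_power)
    also have "\<dots> = ?b * ((1 - w / (1 - p)) ^ (n - j) * (1 + w / p) ^ j)"
    proof -
      have "(p + w) ^ j = p ^ j * (1 + w / p) ^ j" 
        using p by (simp add: field_simps flip: power_mult_distrib)
      moreover have "(1 - p - w) ^ (n - j) = (1 - p) ^ (n - j) * (1 - w / (1 - p)) ^ (n - j)"
        using p by (simp add: field_simps flip: power_mult_distrib)
      ultimately show ?thesis by simp
    qed
    finally show "poly (\<Sum>k\<le>n. monom (real (n choose k) * ?c k) k) w = poly (smult ?b ?K) w"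
      by (simp add: poly_sum poly_monom mult_ac)
  qed
  hence "coeff (\<Sum>k\<le>n. monom (real (n choose k) * ?c k) k) k = coeff (smult ?b ?K) k"
    by simp
  thus ?thesis using k by (simp add: coeff_sum krawtchouk_def)
qed

text \<open>
  In homogeneous form the generating function of the sum can be evaluated at the two factors \<open>U\<close> and
  \<open>V\<close> of the generating function of the Krawtchouk polynomials, which are polynomials themselves.
\<close>

lemma sum_coeff_homogeneous:
  fixes a b :: "'b \<Rightarrow> real" and U V :: "real poly"
  assumes A: "finite A"
  shows "(\<Sum>j\<le>card A. smult (coeff (\<Prod>i\<in>A. [:a i, b i:]) j) (U ^ (card A - j) * V ^ j))
         = (\<Prod>i\<in>A. smult (a i) U + smult (b i) V)"
  using A
proof (induction A rule: finite_induct)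
  case (insert x A)
  let ?P = "\<Prod>i\<in>A. [:a i, b i:]" and ?n = "card A"
  \<comment> \<open>the sum for \<open>A\<close> can be extended by a zero term to the range for \<open>insert x A\<close>\<close>
  have deg: "coeff ?P (Suc ?n) = 0"
  proof (rule coeff_eq_0)
    have "degree ?P \<le> (\<Sum>i\<in>A. degree [:a i, b i:])"
      using degree_prod_sum_le[OF insert.hyps(1), of "\<lambda>i. [:a i, b i:]"] by (simp add: o_def del: degree_pCons_eq_if)
    also have "\<dots> \<le> (\<Sum>i\<in>A. 1)" by (intro sum_mono) simp
    finally show "degree ?P < Suc ?n" by simp
  qed
  have "(\<Prod>i\<in>insert x A. smult (a i) U + smult (b i) V)
     = (\<Sum>j\<le>?n. smult (coeff ?P j) (U ^ (?n - j) * V ^ j)) * (smult (a x) U + smult (b x) V)"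
    using insert by simp
  also have "\<dots> = (\<Sum>j\<le>?n. smult (a x * coeff ?P j) (U ^ (Suc ?n - j) * V ^ j))
                + (\<Sum>j\<le>?n. smult (b x * coeff ?P j) (U ^ (Suc ?n - Suc j) * V ^ Suc j))"
    unfolding distrib_left sum_distrib_right
    by (intro arg_cong2[of _ _ _ _ "(+)"] sum.cong refl) (simp_all add: Suc_diff_le mult_ac)
  also have "(\<Sum>j\<le>?n. smult (a x * coeff ?P j) (U ^ (Suc ?n - j) * V ^ j))
           = (\<Sum>j\<le>Suc ?n. smult (a x * coeff ?P j) (U ^ (Suc ?n - j) * V ^ j))"
    by (simp add: deg)
  also have "(\<Sum>j\<le>?n. smult (b x * coeff ?P j) (U ^ (Suc ?n - Suc j) * V ^ Suc j))
           = (\<Sum>j\<le>Suc ?n. smult (b x * (case j of 0 \<Rightarrow> 0 | Suc i \<Rightarrow> coeff ?P i)) (U ^ (Suc ?n - j) * V ^ j))"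
    by (simp add: sum.atMost_Suc_shift del: sum.atMost_Suc)
  also have "(\<Sum>j\<le>Suc ?n. smult (a x * coeff ?P j) (U ^ (Suc ?n - j) * V ^ j)) + \<dots>
           = (\<Sum>j\<le>Suc ?n. smult (coeff (\<Prod>i\<in>insert x A. [:a i, b i:]) j) (U ^ (Suc ?n - j) * V ^ j))"
    unfolding sum.distrib[symmetric] smult_add_left[symmetric]
    using insert.hyps by (intro sum.cong refl arg_cong2[of _ _ _ _ smult]) (simp add: coeff_pCons split: nat.split)
  finally show ?case using insert.hyps by simp
qed simp

text \<open>
  The expectation of the \<open>k\<close>-th Krawtchouk polynomial at the sum: substituting \<open>1 - v/q\<close>
  for failure and \<open>1 + v/p\<close> for success turns each factor into \<open>1 + y_i v / (p q)\<close>, since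
  \<open>q (1 - v/q) + p (1 + v/p) = 1\<close>.
\<close>

lemma sum_coeff_krawtchouk:
  assumes A: "finite A" and p: "0 < p" "p < 1" and k: "k \<le> card A"
  shows "(\<Sum>j\<le>card A. coeff (\<Prod>i\<in>A. [:1 - p - y i, p + y i:]) j * krawtchouk p (card A) k j)
         = esym k A y / (p * (1 - p)) ^ k"
proof -
  have "(\<Sum>j\<le>card A. smult (coeff (\<Prod>i\<in>A. [:1 - p - y i, p + y i:]) j) 
           ([:1, - 1 / (1 - p):] ^ (card A - j) * [:1, 1 / p:] ^ j))
      = (\<Prod>i\<in>A. smult (1 - p - y i) [:1, - 1 / (1 - p):] + smult (p + y i) [:1, 1 / p:])"
    by (rule sum_coeff_homogeneous[OF A])
  also have "\<dots> = (\<Prod>i\<in>A. [:1, 1 / (p * (1 - p)) * y i:])"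
    using p by (intro prod.cong) (auto simp: field_simps)
  finally have "coeff (\<Sum>j\<le>card A. smult (coeff (\<Prod>i\<in>A. [:1 - p - y i, p + y i:]) j) 
           ([:1, - 1 / (1 - p):] ^ (card A - j) * [:1, 1 / p:] ^ j)) k
      = coeff (\<Prod>i\<in>A. [:1, 1 / (p * (1 - p)) * y i:]) k" by (rule arg_cong)
  also have "\<dots> = esym k A y / (p * (1 - p)) ^ k"
    unfolding coeff_prod_linear[OF A k] by (simp add: power_one_over)
  finally show ?thesis
    unfolding krawtchouk_def coeff_sum coeff_smult .
qed

text \<open>
  One factor \<open>P j\<close> of the square is expanded, \<open>P j = (\<Sum>k. e_k(y) c_k(j))\<close>, the other is kept and
  summed against the Krawtchouk polynomials that \<open>c_k(j)\<close> is proportional to, which produces a second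
  factor \<open>e_k(y)\<close>. This is the Parseval identity for the density of the sum.
\<close>

lemma sum_sq_div_binomial:
  assumes A: "finite A" and p: "0 < p" "p < 1"
  shows "(\<Sum>j\<le>card A. (coeff (\<Prod>i\<in>A. [:1 - p - y i, p + y i:]) j)\<^sup>2
                / (real (card A choose j) * p ^ j * (1 - p) ^ (card A - j)))
         = (\<Sum>k\<le>card A. (esym k A y)\<^sup>2 / (real (card A choose k) * (p * (1 - p)) ^ k))"
proof -
  define n where "n = card A"
  define P where "P = (\<lambda>j. coeff (\<Prod>i\<in>A. [:1 - p - y i, p + y i:]) j)"
  define b where "b = (\<lambda>j. real (n choose j) * p ^ j * (1 - p) ^ (n - j))"
  define c where "c = (\<lambda>k j. coeff ([:-1, 1:] ^ k * [:1 - p, p:] ^ (n - k)) j)"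
  have P: "P j = (\<Sum>k\<le>n. esym k A y * c k j)" for j
  proof -
    have "(\<Prod>i\<in>A. [:1 - p - y i, p + y i:]) = (\<Prod>i\<in>A. [:1 - p, p:] + smult (y i) [:-1, 1:])"
      by simp
    thus ?thesis unfolding prod_poly_eq_sum_esym[OF A] P_def c_def n_def
      by (simp add: coeff_sum)
  qed
  have c: "c k j = b j * krawtchouk p n k j / real (n choose k)" if "j \<le> n" "k \<le> n" for j k
    using coeff_krawtchouk_dual[OF p that] that by (simp add: b_def c_def field_simps)
  have b: "b j > 0" if "j \<le> n" for j
    using p that by (simp add: b_def)
  have "(\<Sum>j\<le>n. (P j)\<^sup>2 / b j) = (\<Sum>j\<le>n. \<Sum>k\<le>n. P j * krawtchouk p n k j * (esym k A y / real (n choose k)))"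
  proof (intro sum.cong refl)
    fix j assume j: "j \<in> {..n}"
    have "(P j)\<^sup>2 / b j = P j / b j * (\<Sum>k\<le>n. esym k A y * c k j)"
      using P[of j] by (simp add: power2_eq_square)
    also have "\<dots> = (\<Sum>k\<le>n. P j * krawtchouk p n k j * (esym k A y / real (n choose k)))"
      unfolding sum_distrib_left using j b[of j] by (intro sum.cong) (auto simp: c)
    finally show "(P j)\<^sup>2 / b j = \<dots>" .
  qed
  also have "\<dots> = (\<Sum>k\<le>n. (\<Sum>j\<le>n. P j * krawtchouk p n k j) * (esym k A y / real (n choose k)))"
    unfolding sum_distrib_right by (rule sum.swap)
  also have "\<dots> = (\<Sum>k\<le>n. (esym k A y)\<^sup>2 / (real (n choose k) * (p * (1 - p)) ^ k))"
    using sum_coeff_krawtchouk[OF A p, of _ y]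
    by (intro sum.cong) (auto simp: P_def n_def power2_eq_square)
  finally show ?thesis unfolding P_def b_def n_def .
qed

section \<open>A bound for elementary symmetric functions\<close>


lemma prod_le_mean_power:
  fixes x :: "'b \<Rightarrow> real"
  assumes "finite A" and x: "\<And>i. i \<in> A \<Longrightarrow> 0 \<le> x i"
  shows "(\<Prod>i\<in>A. x i) \<le> ((\<Sum>i\<in>A. x i) / card A) ^ card A"
proof (cases "A = {} \<or> (\<Prod>i\<in>A. x i) = 0")
  case True
  have "0 \<le> (\<Sum>i\<in>A. x i)" using x by (rule sum_nonneg)
  thus ?thesis using True by auto
next
  case False
  have pos: "0 < (\<Prod>i\<in>A. x i)" using False prod_nonneg[of A x] x by force
  have n: "card A > 0" using False assms by auto
  have "(\<Prod>i\<in>A. x i) = ((\<Prod>i\<in>A. x i) powr (1 / card A)) ^ card A"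
    using pos n by (simp add: powr_power)
  also have "\<dots> \<le> (\<Sum>i\<in>A. x i / card A) ^ card A"
    using arith_geom_mean[of A x] False assms by (intro power_mono) auto
  finally show ?thesis by (simp add: sum_divide_distrib)
qed

lemma parseval_roots_of_unity:
  fixes c :: "nat \<Rightarrow> real" and n :: nat
  defines "w \<equiv> exp (2 * of_real pi * \<i> / of_nat (Suc n))"
  shows "(\<Sum>m<Suc n. (cmod (\<Sum>k\<le>n. of_real (c k) * (w ^ m) ^ k))\<^sup>2) = real (Suc n) * (\<Sum>k\<le>n. (c k)\<^sup>2)"
proof -
  have wk: "w ^ k = exp (2 * of_real pi * \<i> * of_nat k / of_nat (Suc n))" for k
    unfolding w_def exp_of_nat_mult[symmetric] by (simp add: field_simps)
  have nw: "w * cnj w = 1"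
    by (simp add: w_def flip: complex_norm_square)
  have wN: "w ^ Suc n = 1"
    using complex_root_unity[of "Suc n" 1] by (simp add: w_def)
  have gs: "(\<Sum>m<Suc n. (w ^ k * cnj w ^ l) ^ m) = (if k = l then of_nat (Suc n) else 0)"
    if kl: "k \<le> n" "l \<le> n" for k l
  proof (cases "k = l")
    case True
    thus ?thesis using nw by (simp flip: power_mult_distrib)
  next
    case False
    have "w ^ k * cnj w ^ l \<noteq> 1"
    proof
      assume "w ^ k * cnj w ^ l = 1"
      hence "w ^ k * (w * cnj w) ^ l = w ^ l" by (simp add: power_mult_distrib mult_ac)
      hence "w ^ k = w ^ l" using nw by simp
      hence "k mod Suc n = l mod Suc n"
        unfolding wk using complex_root_unity_eq[of "Suc n" k l] by simp
      thus False using kl False by simp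
    qed
    moreover have "(w ^ k * cnj w ^ l) ^ Suc n = (w ^ Suc n) ^ k * cnj (w ^ Suc n) ^ l"
      unfolding complex_cnj_power power_mult_distrib power_mult[symmetric] by (simp only: mult.commute)
    hence "(w ^ k * cnj w ^ l) ^ Suc n = 1" unfolding wN by simp
    ultimately show ?thesis using False geometric_sum[of "w ^ k * cnj w ^ l" "Suc n"] by simp
  qed
  have "complex_of_real (\<Sum>m<Suc n. (cmod (\<Sum>k\<le>n. of_real (c k) * (w ^ m) ^ k))\<^sup>2)
      = (\<Sum>m<Suc n. (\<Sum>k\<le>n. of_real (c k) * (w ^ m) ^ k) * (\<Sum>l\<le>n. of_real (c l) * (cnj w ^ m) ^ l))"
    unfolding of_real_sum complex_norm_square by simp
  also have "\<dots> = (\<Sum>m<Suc n. \<Sum>k\<le>n. \<Sum>l\<le>n. of_real (c k * c l) * (w ^ k * cnj w ^ l) ^ m)"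
    by (simp add: sum_product power_mult_distrib mult_ac flip: power_mult)
  also have "\<dots> = (\<Sum>k\<le>n. \<Sum>m<Suc n. \<Sum>l\<le>n. of_real (c k * c l) * (w ^ k * cnj w ^ l) ^ m)"
    by (rule sum.swap)
  also have "\<dots> = (\<Sum>k\<le>n. \<Sum>l\<le>n. of_real (c k * c l) * (\<Sum>m<Suc n. (w ^ k * cnj w ^ l) ^ m))"
    unfolding sum_distrib_left by (intro sum.cong refl sum.swap)
  also have "\<dots> = (\<Sum>k\<le>n. \<Sum>l\<le>n. if k = l then of_real (c k * c l) * of_nat (Suc n) else 0)"
    by (intro sum.cong refl) (use gs in auto)
  also have "\<dots> = (\<Sum>k\<le>n. of_real (c k * c k) * of_nat (Suc n))"
    by (intro sum.cong refl, subst sum.delta') auto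
  also have "\<dots> = complex_of_real (real (Suc n) * (\<Sum>k\<le>n. (c k)\<^sup>2))"
    by (simp add: power2_eq_square sum_distrib_left mult_ac)
  finally show ?thesis unfolding of_real_eq_iff .
qed

text \<open>
  The numbers \<open>e_k(x) b^k a^(n - k)\<close>, where \<open>a^2 = s\<close> and \<open>b^2 = t\<close>, are the coefficients of the
  polynomial \<open>\<Prod>i. (a + b x_i u)\<close> in \<open>u\<close>. For \<open>|u| = 1\<close> the factors have squared modulus
  \<open>s + 2 a b x_i Re u + t x_i^2\<close>, whose mean over \<open>i\<close> is \<open>s + t d\<close> because \<open>\<Sum>i. x_i = 0\<close>. The inequality
  of the means bounds the squared modulus of the product at each such \<open>u\<close>, and Parseval's identity
  turns this into a bound for the sum of the squared coefficients.
\<close>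

lemma sum_esym_sq_homogeneous_le:
  fixes x :: "'b \<Rightarrow> real" and d :: real
  assumes A: "finite A" and x1: "(\<Sum>i\<in>A. x i) = 0" and x2: "(\<Sum>i\<in>A. (x i)\<^sup>2) = card A * d"
    and s: "0 \<le> s" and t: "0 \<le> t"
  shows "(\<Sum>k\<le>card A. (esym k A x)\<^sup>2 * t ^ k * s ^ (card A - k)) \<le> (s + t * d) ^ card A"
proof -
  define n where "n = card A"
  define a b where "a = sqrt s" and "b = sqrt t"
  define w where "w = exp (2 * of_real pi * \<i> / of_nat (Suc n))"
  define c where "c = (\<lambda>k. esym k A x * b ^ k * a ^ (n - k))"
  have le: "(cmod (\<Sum>k\<le>n. of_real (c k) * u ^ k))\<^sup>2 \<le> (s + t * d) ^ n" if u: "cmod u = 1" for u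
  proof (cases "A = {}")
    case True
    thus ?thesis by (simp add: n_def c_def)
  next
    case False
    hence n0: "n > 0" using A by (auto simp: n_def card_gt_0_iff)
    have "(\<Sum>k\<le>n. of_real (c k) * u ^ k) = (\<Prod>i\<in>A. of_real a + (of_real b * u) * of_real (x i))"
      unfolding prod_eq_sum_esym[OF A] esym_of_real
      by (simp add: c_def n_def power_mult_distrib mult_ac)
    hence "(cmod (\<Sum>k\<le>n. of_real (c k) * u ^ k))\<^sup>2
        = (\<Prod>i\<in>A. (cmod (of_real a + (of_real b * u) * of_real (x i)))\<^sup>2)"
      by (simp only: prod_norm[symmetric] prod_power_distrib)
    also have "\<dots> \<le> ((\<Sum>i\<in>A. (cmod (of_real a + (of_real b * u) * of_real (x i)))\<^sup>2) / n) ^ n"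
      unfolding n_def by (rule prod_le_mean_power[OF A]) simp
    also have "(\<Sum>i\<in>A. (cmod (of_real a + (of_real b * u) * of_real (x i)))\<^sup>2) = 
               (\<Sum>i\<in>A. s + 2 * a * b * Re u * x i + t * (x i)\<^sup>2)"
    proof (intro sum.cong refl)
      fix i
      have "(Re u)\<^sup>2 + (Im u)\<^sup>2 = 1" using u by (metis cmod_power2 power_one)
      hence im: "(Im u)\<^sup>2 = 1 - (Re u)\<^sup>2" by simp
      have "(cmod (of_real a + (of_real b * u) * of_real (x i)))\<^sup>2
          = (a + b * Re u * x i)\<^sup>2 + b\<^sup>2 * (x i)\<^sup>2 * (Im u)\<^sup>2"
        by (simp add: cmod_power2 power_mult_distrib)
      also have "\<dots> = a\<^sup>2 + 2 * a * b * Re u * x i + b\<^sup>2 * (x i)\<^sup>2"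
        unfolding im by (simp add: power2_eq_square algebra_simps)
      finally show "(cmod (of_real a + (of_real b * u) * of_real (x i)))\<^sup>2 = s + 2 * a * b * Re u * x i + t * (x i)\<^sup>2"
        using s t by (simp add: a_def b_def)
    qed
    also have "\<dots> = real n * s + 2 * a * b * Re u * (\<Sum>i\<in>A. x i) + t * (\<Sum>i\<in>A. (x i)\<^sup>2)"
      by (simp add: sum.distrib sum_distrib_left n_def)
    also have "\<dots> / n = s + t * d"
      using n0 by (simp add: x1 x2 field_simps flip: n_def)
    finally show ?thesis .
  qed
  have "real (Suc n) * (\<Sum>k\<le>n. (c k)\<^sup>2) = (\<Sum>m<Suc n. (cmod (\<Sum>k\<le>n. of_real (c k) * (w ^ m) ^ k))\<^sup>2)"
    unfolding w_def by (rule parseval_roots_of_unity[symmetric])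
  also have "\<dots> \<le> (\<Sum>m<Suc n. (s + t * d) ^ n)"
    by (intro sum_mono le) (simp add: w_def norm_power)
  finally have "(\<Sum>k\<le>n. (c k)\<^sup>2) \<le> (s + t * d) ^ n"
    by (simp del: of_nat_Suc)
  moreover have "(c k)\<^sup>2 = (esym k A x)\<^sup>2 * t ^ k * s ^ (n - k)" for k
  proof -
    have "(b ^ k)\<^sup>2 = t ^ k" "(a ^ (n - k))\<^sup>2 = s ^ (n - k)"
      using s t by (simp_all only: a_def b_def power_commutes power2_eq_square flip: power_mult_distrib)
        simp_all
    thus ?thesis by (simp add: c_def power_mult_distrib)
  qed
  ultimately show ?thesis by (simp add: n_def)
qed

lemma has_integral_power_beta:
  assumes "k \<le> n"
  shows "((\<lambda>t::real. t ^ k * (1 - t) ^ (n - k)) has_integral 1 / (real (Suc n) * real (n choose k))) {0..1}"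
proof -
  have G: "Gamma (real m + 1) = fact m" for m
    using Gamma_fact[of m, where ?'a = real] by (simp add: add.commute)
  have "Beta (real k + 1) (real (n - k) + 1) = fact k * fact (n - k) / fact (Suc n)"
    unfolding Beta_def G using assms G[of "Suc n"] by (simp add: of_nat_diff algebra_simps)
  also have "\<dots> = 1 / (real (Suc n) * real (n choose k))"
    using assms by (simp add: binomial_fact field_simps)
  finally have B: "Beta (real k + 1) (real (n - k) + 1) = 1 / (real (Suc n) * real (n choose k))" .
  have "((\<lambda>t. t powr (real k + 1 - 1) * (1 - t) powr (real (n - k) + 1 - 1)) has_integral
          1 / (real (Suc n) * real (n choose k))) {0..1}"
    unfolding B[symmetric] by (rule has_integral_Beta_real) auto
  thus ?thesis
    \<comment> \<open>real and natural powers differ only for \<open>0 ^ 0\<close>, at the end points\<close>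
    by (rule has_integral_spike_finite[of "{0, 1}", rotated 2]) (auto simp: powr_realpow)
qed

text \<open>
  The reciprocal binomial coefficients come from the beta integral
  \<open>1 / (n choose k) = (n + 1) \<integral> t^k (1 - t)^(n - k) dt\<close>, so the preceding bound, used with \<open>1 - t\<close>
  and \<open>t u\<close>, can be integrated termwise: the result is
  \<open>(n + 1) \<integral> (1 - t + t u d)^n dt = (1 - (u d)^(n + 1)) / (1 - u d)\<close>.
\<close>

lemma sum_esym_sq_div_binomial_le:
  fixes x :: "'b \<Rightarrow> real" and d :: real
  assumes A: "finite A" and x1: "(\<Sum>i\<in>A. x i) = 0" and x2: "(\<Sum>i\<in>A. (x i)\<^sup>2) = card A * d"
    and d: "0 \<le> d" and u: "0 \<le> u" "u * d < 1"
  shows "(\<Sum>k\<le>card A. u ^ k * (esym k A x)\<^sup>2 / real (card A choose k)) \<le> 1 / (1 - u * d)"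
proof -
  define n where "n = card A"
  define r where "r = u * d"
  have r: "0 \<le> r" "r < 1" using d u by (auto simp: r_def)
  have "((\<lambda>t. \<Sum>k\<le>n. u ^ k * (esym k A x)\<^sup>2 * (t ^ k * (1 - t) ^ (n - k))) has_integral
         (\<Sum>k\<le>n. u ^ k * (esym k A x)\<^sup>2 * (1 / (real (Suc n) * real (n choose k))))) {0..1}"
    by (intro has_integral_sum has_integral_mult_right has_integral_power_beta) auto
  moreover have "((\<lambda>t. (1 - t + t * r) ^ n) has_integral
      (- ((1 - 1 + 1 * r) ^ Suc n) / (real (Suc n) * (1 - r))
       - (- ((1 - 0 + 0 * r) ^ Suc n) / (real (Suc n) * (1 - r))))) {0..1}"
  proof (rule fundamental_theorem_of_calculus)
    fix t :: real
    have "((\<lambda>t. - ((1 - t + t * r) ^ Suc n) / (real (Suc n) * (1 - r))) has_real_derivative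
          - (real (Suc n) * (1 - t + t * r) ^ n * (r - 1)) / (real (Suc n) * (1 - r))) (at t within {0..1})"
      using r by (auto intro!: derivative_eq_intros simp del: of_nat_Suc power_Suc)
    also have "- (real (Suc n) * (1 - t + t * r) ^ n * (r - 1)) / (real (Suc n) * (1 - r)) = (1 - t + t * r) ^ n"
      using r by (simp add: divide_simps del: of_nat_Suc) (simp add: algebra_simps)
    finally show "((\<lambda>t. - ((1 - t + t * r) ^ Suc n) / (real (Suc n) * (1 - r))) has_vector_derivative
          (1 - t + t * r) ^ n) (at t within {0..1})"
      by (simp add: has_real_derivative_iff_has_vector_derivative)
  qed simp
  ultimately have "(\<Sum>k\<le>n. u ^ k * (esym k A x)\<^sup>2 * (1 / (real (Suc n) * real (n choose k))))
      \<le> - ((1 - 1 + 1 * r) ^ Suc n) / (real (Suc n) * (1 - r)) - (- ((1 - 0 + 0 * r) ^ Suc n) / (real (Suc n) * (1 - r)))"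
  proof (rule has_integral_le)
    fix t :: real assume t: "t \<in> {0..1}"
    have "(\<Sum>k\<le>n. u ^ k * (esym k A x)\<^sup>2 * (t ^ k * (1 - t) ^ (n - k)))
        = (\<Sum>k\<le>n. (esym k A x)\<^sup>2 * (t * u) ^ k * (1 - t) ^ (n - k))"
      by (simp add: power_mult_distrib mult_ac)
    also have "\<dots> \<le> (1 - t + (t * u) * d) ^ n"
      unfolding n_def using t u by (intro sum_esym_sq_homogeneous_le A x1 x2) auto
    finally show "(\<Sum>k\<le>n. u ^ k * (esym k A x)\<^sup>2 * (t ^ k * (1 - t) ^ (n - k))) \<le> (1 - t + t * r) ^ n"
      by (simp add: r_def mult_ac)
  qed
  also have "\<dots> \<le> 1 / (real (Suc n) * (1 - r))"
    using r by (simp add: divide_simps del: of_nat_Suc)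
  also have "(\<Sum>k\<le>n. u ^ k * (esym k A x)\<^sup>2 * (1 / (real (Suc n) * real (n choose k))))
      = (\<Sum>k\<le>n. u ^ k * (esym k A x)\<^sup>2 / real (n choose k)) / real (Suc n)"
    by (simp add: sum_divide_distrib mult_ac)
  also have "1 / (real (Suc n) * (1 - r)) = 1 / (1 - r) / real (Suc n)"
    by simp
  finally show ?thesis unfolding n_def r_def
    by (simp only: divide_le_cancel of_nat_0_less_iff)
qed

text \<open>
  The free parameter \<open>u \<ge> 1\<close> of the preceding bound extracts the factor \<open>d^3\<close>: a tail starting
  at \<open>k = 3\<close> is at most \<open>u^(-3) / (1 - u d)\<close>. The choice \<open>u d = (1 + d) / 2\<close> keeps \<open>1 - u d\<close>
  proportional to \<open>1 - d\<close> while \<open>u^(-3) \<le> 8 d^3\<close>.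
\<close>

lemma sum_esym_sq_tail_le:
  fixes x :: "'b \<Rightarrow> real" and d :: real
  assumes A: "finite A" and x1: "(\<Sum>i\<in>A. x i) = 0" and x2: "(\<Sum>i\<in>A. (x i)\<^sup>2) = card A * d"
    and d: "0 \<le> d" "d < 1"
  shows "(\<Sum>k=3..card A. (esym k A x)\<^sup>2 / real (card A choose k)) \<le> 16 * d ^ 3 / (1 - d)"
proof (cases "d = 0")
  case True
  have "x i = 0" if "i \<in> A" for i
    using x2 that A True by (simp add: sum_nonneg_eq_0_iff)
  hence "esym k A x = 0" if "k \<ge> 3" for k
    unfolding esym_def
  proof (intro sum.neutral ballI)
    fix X assume X: "X \<in> {X. X \<subseteq> A \<and> card X = k}"
    hence "finite X" "X \<noteq> {}" using that by (auto simp: card_eq_0_iff intro: card_ge_0_finite)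
    thus "(\<Prod>i\<in>X. x i) = 0" using X \<open>\<And>i. i \<in> A \<Longrightarrow> x i = 0\<close> by (intro prod_zero) auto
  qed
  thus ?thesis using True by simp
next
  case False
  define n where "n = card A"
  define u where "u = (1 + d) / (2 * d)"
  have u: "u \<ge> 1" "u * d = (1 + d) / 2" using d False by (auto simp: u_def field_simps)
  have u': "0 \<le> u" "u * d < 1" using u d by simp_all
  have "u ^ 3 * (\<Sum>k=3..n. (esym k A x)\<^sup>2 / real (n choose k))
      = (\<Sum>k=3..n. u ^ 3 * ((esym k A x)\<^sup>2 / real (n choose k)))"
    by (simp add: sum_distrib_left)
  also have "\<dots> \<le> (\<Sum>k=3..n. u ^ k * ((esym k A x)\<^sup>2 / real (n choose k)))"
    using u by (intro sum_mono mult_right_mono power_increasing) auto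
  also have "\<dots> \<le> (\<Sum>k\<le>n. u ^ k * ((esym k A x)\<^sup>2 / real (n choose k)))"
    using u by (intro sum_mono2) auto
  also have "\<dots> \<le> 1 / (1 - u * d)"
    using sum_esym_sq_div_binomial_le[OF A x1 x2 d(1) u'] by (simp add: n_def)
  also have "\<dots> = 2 / (1 - d)" unfolding u(2) using d by (simp add: field_simps)
  finally have "(\<Sum>k=3..n. (esym k A x)\<^sup>2 / real (n choose k)) \<le> 2 / (1 - d) / u ^ 3"
    using u by (subst pos_le_divide_eq) (auto simp: mult.commute)
  also have "2 / (1 - d) / u ^ 3 = 16 * d ^ 3 / (1 - d) / (1 + d) ^ 3"
    using d False by (simp add: u_def power_divide power_mult_distrib)
  also have "\<dots> \<le> 16 * d ^ 3 / (1 - d)"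
  proof -
    have "(1 + d) ^ 3 \<ge> 1" using d by (intro one_le_power) auto
    hence "16 * d ^ 3 / (1 - d) / (1 + d) ^ 3 \<le> 16 * d ^ 3 / (1 - d) / 1"
      using d by (intro divide_left_mono) auto
    thus ?thesis by simp
  qed
  finally show ?thesis by (simp add: n_def)
qed

section \<open>Total variation distance\<close>


lemma sum_abs_diff_le_chi_square:
  fixes P b :: "'b \<Rightarrow> real"
  assumes b: "\<And>j. j \<in> I \<Longrightarrow> 0 < b j" and "sum b I = 1" "sum P I = 1"
  shows "(\<Sum>j\<in>I. \<bar>P j - b j\<bar>) \<le> sqrt ((\<Sum>j\<in>I. (P j)\<^sup>2 / b j) - 1)"
proof (rule real_le_rsqrt)
  have "(\<Sum>j\<in>I. \<bar>P j - b j\<bar>)\<^sup>2 = (\<Sum>j\<in>I. \<bar>P j - b j\<bar> / sqrt (b j) * sqrt (b j))\<^sup>2"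
    by (intro arg_cong[where f = "\<lambda>x. x\<^sup>2"] sum.cong refl) (use b in force)
  also have "\<dots> \<le> (\<Sum>j\<in>I. (\<bar>P j - b j\<bar> / sqrt (b j))\<^sup>2) * (\<Sum>j\<in>I. (sqrt (b j))\<^sup>2)"
    by (rule Cauchy_Schwarz_ineq_sum)
  also have "(\<Sum>j\<in>I. (sqrt (b j))\<^sup>2) = 1"
    using assms by (simp add: less_imp_le)
  also have "(\<Sum>j\<in>I. (\<bar>P j - b j\<bar> / sqrt (b j))\<^sup>2) = (\<Sum>j\<in>I. (P j)\<^sup>2 / b j - 2 * P j + b j)"
    by (intro sum.cong refl)
       (use b in \<open>force simp: power_divide less_imp_le field_simps power2_eq_square\<close>)
  also have "\<dots> = (\<Sum>j\<in>I. (P j)\<^sup>2 / b j) - 2 * sum P I + sum b I"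
    by (simp add: sum.distrib sum_subtractf sum_distrib_left)
  finally show "(\<Sum>j\<in>I. \<bar>P j - b j\<bar>)\<^sup>2 \<le> (\<Sum>j\<in>I. (P j)\<^sup>2 / b j) - 1"
    using assms by simp
qed

text \<open>
  The leading constant of the theorem arises here: \<open>e_1\<close> vanishes and \<open>e_2 = - n d / 2\<close>, so the
  term \<open>k = 2\<close> is \<open>n d^2 / (2 (n - 1))\<close>.
\<close>

lemma sum_esym_sq_total_le:
  fixes x :: "'b \<Rightarrow> real" and d :: real
  assumes A: "finite A" "2 \<le> card A" and x1: "(\<Sum>i\<in>A. x i) = 0"
    and x2: "(\<Sum>i\<in>A. (x i)\<^sup>2) = card A * d" and d: "0 \<le> d" "d < 1"
  shows "(\<Sum>k\<le>card A. (esym k A x)\<^sup>2 / real (card A choose k))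
         \<le> 1 + real (card A) / (2 * (real (card A) - 1)) * d\<^sup>2 + 16 * d ^ 3 / (1 - d)"
proof -
  define n where "n = card A"
  define f where "f = (\<lambda>k. (esym k A x)\<^sup>2 / real (n choose k))"
  have n: "2 \<le> n" using A by (simp add: n_def)
  have e2: "esym 2 A x = - (real n * d / 2)"
    using esym_2[OF A(1), of x] x1 x2 by (simp add: n_def)
  have "{..n} = {0, 1, 2} \<union> {3..n}" using n by auto
  hence "sum f {..n} = sum f {0, 1, 2} + sum f {3..n}"
    by (simp only:) (rule sum.union_disjoint, auto)
  also have "sum f {0, 1, 2} = 1 + f 2"
    using A x1 by (simp add: f_def esym_1)
  also have "f 2 = real n / (2 * (real n - 1)) * d\<^sup>2"
  proof -
    have "real (n choose 2) = real n * (real n - 1) / 2"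
      using n by (simp add: choose_two real_of_nat_div of_nat_diff)
    thus ?thesis unfolding f_def e2 using n by (simp only:) (simp add: field_simps power2_eq_square)
  qed
  also have "sum f {3..n} \<le> 16 * d ^ 3 / (1 - d)"
    using sum_esym_sq_tail_le[OF A(1) x1 x2 d] by (simp add: f_def n_def)
  finally show ?thesis by (simp add: f_def n_def)
qed

lemma dTV_sum_indicators_le:
  fixes p :: "nat \<Rightarrow> real"
  assumes n: "2 \<le> n" and p: "\<forall>j\<in>{1..n}. 0 \<le> p j \<and> p j \<le> 1"
    and m: "0 < mean_p n p" "mean_p n p < 1"
    and d: "delta_m 2 n p < 1"
  shows "dTV n (sum_indicators_pmf n p) (binomial_pmf n (mean_p n p))
       \<le> 1 / 2 * sqrt (real n / (2 * (real n - 1)) * (delta_m 2 n p)\<^sup>2 + 16 * delta_m 2 n p ^ 3 / (1 - delta_m 2 n p))"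
proof -
  define A where "A = {1..n}"
  define \<mu> where "\<mu> = mean_p n p"
  define \<delta> where "\<delta> = delta_m 2 n p"
  define y where "y = (\<lambda>i. p i - \<mu>)"
  define v where "v = sqrt (\<mu> * (1 - \<mu>))"
  define x where "x = (\<lambda>i. 1 / v * y i)"
  define P where "P = (\<lambda>j. coeff (\<Prod>i\<in>A. [:1 - \<mu> - y i, \<mu> + y i:]) j)"
  define b where "b = (\<lambda>j. real (n choose j) * \<mu> ^ j * (1 - \<mu>) ^ (n - j))"
  have A: "finite A" "card A = n" by (simp_all add: A_def)
  have m: "0 < \<mu>" "\<mu> < 1" using m by (simp_all add: \<mu>_def)
  have v: "v > 0" "v\<^sup>2 = \<mu> * (1 - \<mu>)" using m by (simp_all add: v_def)
  have x1: "(\<Sum>i\<in>A. x i) = 0"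
    using n by (simp add: x_def y_def sum_subtractf A(2) \<mu>_def mean_p_def flip: sum_divide_distrib) (simp add: A_def)
  have sq: "\<bar>z\<bar> powr 2 = z\<^sup>2" for z :: real
    by (cases "z = 0") (simp_all add: powr_numeral)
  have \<delta>: "\<delta> = (\<Sum>i\<in>A. (y i)\<^sup>2) / (real n * (\<mu> * (1 - \<mu>)))"
    unfolding \<delta>_def delta_m_def using m
    by (simp add: \<mu>_def y_def A_def sq)
  have "(\<Sum>i\<in>A. (x i)\<^sup>2) = (\<Sum>i\<in>A. (y i)\<^sup>2) / v\<^sup>2"
    by (simp add: x_def power_divide sum_divide_distrib)
  hence x2: "(\<Sum>i\<in>A. (x i)\<^sup>2) = card A * \<delta>"
    using n m by (simp add: \<delta> v A)
  have \<delta>0: "0 \<le> \<delta>" unfolding \<delta> using m by (intro divide_nonneg_nonneg sum_nonneg) auto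
  have pmf_S: "pmf (sum_indicators_pmf n p) j = P j" for j
    unfolding sum_indicators_pmf_def P_def y_def A_def using p by (subst pmf_sum_bernoulli) auto
  have pmf_b: "pmf (binomial_pmf n \<mu>) j = b j" for j
    using m by (simp add: b_def)
  have b0: "b j > 0" if "j \<in> {..n}" for j
    using that m by (simp add: b_def)
  have sb: "sum b {..n} = 1"
    unfolding b_def using binomial_ring[of \<mu> "1 - \<mu>" n] by simp
  \<comment> \<open>the Krawtchouk polynomial of index \<open>0\<close> is the constant \<open>1\<close>\<close>
  have sP: "sum P {..n} = 1"
    using sum_coeff_krawtchouk[OF A(1) m, of 0 y] by (simp add: krawtchouk_def coeff_0_power coeff_mult_0 P_def A)
  have "(\<Sum>j\<le>n. (P j)\<^sup>2 / b j) = (\<Sum>k\<le>n. (esym k A y)\<^sup>2 / (real (n choose k) * (\<mu> * (1 - \<mu>)) ^ k))"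
    using sum_sq_div_binomial[OF A(1) m, of y] by (simp add: P_def b_def A)
  also have "\<dots> = (\<Sum>k\<le>n. (esym k A x)\<^sup>2 / real (n choose k))"
  proof (intro sum.cong refl)
    fix k
    have "(esym k A x)\<^sup>2 = (esym k A y)\<^sup>2 / (v\<^sup>2) ^ k"
      unfolding x_def esym_cmult by (simp add: power_mult_distrib power_divide flip: power_mult) (simp add: mult.commute)
    thus "(esym k A y)\<^sup>2 / (real (n choose k) * (\<mu> * (1 - \<mu>)) ^ k) = (esym k A x)\<^sup>2 / real (n choose k)"
      unfolding v by simp
  qed
  also have "\<dots> \<le> 1 + real n / (2 * (real n - 1)) * \<delta>\<^sup>2 + 16 * \<delta> ^ 3 / (1 - \<delta>)"
    using sum_esym_sq_total_le[OF A(1) _ x1 x2 \<delta>0] n d by (simp add: A \<delta>_def)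
  finally have chi: "(\<Sum>j\<le>n. (P j)\<^sup>2 / b j) - 1 \<le> real n / (2 * (real n - 1)) * \<delta>\<^sup>2 + 16 * \<delta> ^ 3 / (1 - \<delta>)"
    by simp
  have "dTV n (sum_indicators_pmf n p) (binomial_pmf n \<mu>) = 1 / 2 * (\<Sum>j\<le>n. \<bar>P j - b j\<bar>)"
    by (simp only: dTV_def pmf_S pmf_b atLeast0AtMost)
  also have "\<dots> \<le> 1 / 2 * sqrt ((\<Sum>j\<le>n. (P j)\<^sup>2 / b j) - 1)"
    using sum_abs_diff_le_chi_square[OF b0 sb sP] by simp
  also have "\<dots> \<le> 1 / 2 * sqrt (real n / (2 * (real n - 1)) * \<delta>\<^sup>2 + 16 * \<delta> ^ 3 / (1 - \<delta>))"
    using chi by simp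
  finally show ?thesis by (simp add: \<mu>_def \<delta>_def)
qed

lemma mean_p_bounds:
  assumes n: "1 \<le> n" and p: "\<forall>j\<in>{1..n}. 0 \<le> p j \<and> p j \<le> 1"
    and ne: "\<not> (\<exists>c\<in>{0, 1}. \<forall>j\<in>{1..n}. p j = c)"
  shows "0 < mean_p n p" "mean_p n p < 1"
proof -
  have "0 < (\<Sum>j=1..n. p j)"
    using ne p by (metis atLeastAtMost_iff finite_atLeastAtMost insertCI less_eq_real_def sum_nonneg sum_nonneg_eq_0_iff)
  thus "0 < mean_p n p" using n by (simp add: mean_p_def)
  have "0 < (\<Sum>j=1..n. 1 - p j)"
  proof -
    obtain j where j: "j \<in> {1..n}" "p j \<noteq> 1" using ne by blast
    show ?thesis by (rule sum_pos2[of _ j]) (use j p in force)+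
  qed
  thus "mean_p n p < 1" using n by (simp add: mean_p_def sum_subtractf)
qed

theorem mainTheorem2:
  shows "\<exists>C::real. C > 0 \<and>
    (\<forall>(n::nat) (p :: nat \<Rightarrow> real).
       n \<ge> 2 \<longrightarrow>
       (\<forall>j\<in>{1..n}. 0 \<le> p j \<and> p j \<le> 1) \<longrightarrow>
       \<not> (\<exists>c\<in>{0, 1}. \<forall>j\<in>{1..n}. p j = c) \<longrightarrow>
       delta_m 2 n p < 1 \<longrightarrow>
       dTV n (sum_indicators_pmf n p) (binomial_pmf n (mean_p n p))
         \<le> 1 / 2 powr (3 / 2) * delta_m 2 n p *
            sqrt (real n / (real n - 1) *
              (1 + C * (delta_m 2 n p / (1 - delta_m 2 n p)
                        + 1 / sqrt (real n) * (delta_m 3 n p / delta_m 2 n p)))))"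
proof (intro exI[of _ 32] conjI allI impI)
  fix n :: nat and p :: "nat \<Rightarrow> real"
  assume n: "n \<ge> 2" and p: "\<forall>j\<in>{1..n}. 0 \<le> p j \<and> p j \<le> 1"
    and ne: "\<not> (\<exists>c\<in>{0, 1}. \<forall>j\<in>{1..n}. p j = c)" and d1: "delta_m 2 n p < 1"
  have m: "0 < mean_p n p" "mean_p n p < 1"
    using mean_p_bounds[OF _ p ne] n by auto
  have nonneg: "0 \<le> delta_m s n p" for s
    unfolding delta_m_def by (intro mult_nonneg_nonneg divide_nonneg_nonneg sum_nonneg) auto
  define d where "d = delta_m 2 n p"
  define r where "r = 1 / sqrt (real n) * (delta_m 3 n p / d)"
  define N where "N = real n / (real n - 1)"
  have d: "0 \<le> d" "d < 1" using nonneg[of 2] d1 by (simp_all add: d_def)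
  have r: "0 \<le> r" unfolding r_def using nonneg d by (intro mult_nonneg_nonneg divide_nonneg_nonneg) auto
  have N: "1 \<le> N" using n by (simp add: N_def)
  have "dTV n (sum_indicators_pmf n p) (binomial_pmf n (mean_p n p))
      \<le> 1 / 2 * sqrt (N / 2 * d\<^sup>2 + 16 * d ^ 3 / (1 - d))"
    using dTV_sum_indicators_le[OF n p m d1] by (simp add: N_def d_def mult.commute)
  also have "\<dots> \<le> 1 / 2 * sqrt (d\<^sup>2 / 2 * (N * (1 + 32 * (d / (1 - d) + r))))"
  proof -
    have "16 * d ^ 3 / (1 - d) = d\<^sup>2 / 2 * (1 * (32 * (d / (1 - d) + 0)))"
      by (simp add: power2_eq_square power3_eq_cube)
    also have "\<dots> \<le> d\<^sup>2 / 2 * (N * (32 * (d / (1 - d) + r)))"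
      using d r N by (intro mult_left_mono mult_mono add_left_mono) auto
    finally show ?thesis by (simp add: algebra_simps)
  qed
  also have "\<dots> = 1 / 2 * (d / sqrt 2 * sqrt (N * (1 + 32 * (d / (1 - d) + r))))"
    using d by (simp add: real_sqrt_mult real_sqrt_divide)
  also have "\<dots> = 1 / 2 powr (3 / 2) * d * sqrt (N * (1 + 32 * (d / (1 - d) + r)))"
  proof -
    have "(2::real) powr (3 / 2) = 2 powr (1 + 1 / 2)" by simp
    also have "\<dots> = 2 * sqrt 2" by (subst powr_add) (simp add: powr_half_sqrt)
    finally show ?thesis by simp
  qed
  finally show "dTV n (sum_indicators_pmf n p) (binomial_pmf n (mean_p n p))
         \<le> 1 / 2 powr (3 / 2) * delta_m 2 n p *
            sqrt (real n / (real n - 1) *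
              (1 + 32 * (delta_m 2 n p / (1 - delta_m 2 n p)
                        + 1 / sqrt (real n) * (delta_m 3 n p / delta_m 2 n p))))"
    unfolding d_def r_def N_def .
qed simp

end
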